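(* Let $H$ be a graph, possibly with loops, and let $G$ be an $H$-colored complete graph of order $n$ with $n\ge 9$, such that for every $x\in V(G)$ the graph $G_x$ is a complete $k_x$-partite graph for some $k_x\in\mathbb{N}$. Suppose that (1) for every $x\in V(G)$, $k_x\ge \frac{n+1}{2}$, (2) $G$ does not contain a cycle of length $3$ with exactly $2$ obstructions, and (3) $G$ does not contain a cycle of length $4$ with exactly $3$ obstructions. Then each vertex of $G$ is contained in an $H$-cycle of length $4$.
   Context: All graphs are finite; $G$ is simple. An $H$-coloring of $G$ is a function $c:E(G)\to V(H)$; $G$ is then called $H$-colored. A cycle $(v_1,\dots,v_k,v_1)$ of $G$ is an $H$-cycle if $(c(v_1v_2),\dots,c(v_{k-1}v_k),c(v_kv_1),c(v_1v_2))$ is a walk in $H$ (consecutive colors must be adjacent in $H$, where a loop at a color allows that color to be repeated). For a vertex $x$ of $G$, $G_x$ is the graph whose vertex set is the set of edges of $G$ incident with $x$, two distinct such edges $a,b$ being adjacent in $G_x$ iff $c(a)c(b)\in E(H)$. A complete $k$-partite graph is one whose vertex set is partitioned into $k$ nonempty independent sets with all edges between distinct parts present. For a cycle $(x_1,\dots,x_{m},x_1)$, a vertex $x_i$ is an obstruction of it if $c(x_{i-1}x_i)c(x_ix_{i+1})\notin E(H)$ (indices modulo $m$). *)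

theory Defs
  imports Complex_Main "HOL-Library.Disjoint_Sets"
begin

record 'a ugraph =
  verts :: "'a set"
  edges :: "'a set set"

(* An edge is the set of its endpoints, so a loop at u is the singleton {u} = {u, u}. Hence
   "{u, v} \<in> edges H" expresses adjacency of u and v uniformly, including the case u = v. *)
definition loop_graph :: "'a ugraph \<Rightarrow> bool" where
  "loop_graph H \<longleftrightarrow> finite (verts H) \<and> (\<forall>e\<in>edges H. e \<subseteq> verts H \<and> card e \<in> {1, 2})"

definition simple_graph :: "'a ugraph \<Rightarrow> bool" where
  "simple_graph G \<longleftrightarrow> finite (verts G) \<and> (\<forall>e\<in>edges G. e \<subseteq> verts G \<and> card e = 2)"

definition complete_graph :: "'a ugraph \<Rightarrow> bool" where
  "complete_graph G \<longleftrightarrow> simple_graph G \<and>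
     (\<forall>u\<in>verts G. \<forall>v\<in>verts G. u \<noteq> v \<longrightarrow> {u, v} \<in> edges G)"

definition complete_multipartite :: "nat \<Rightarrow> 'a ugraph \<Rightarrow> bool" where
  "complete_multipartite k K \<longleftrightarrow> simple_graph K \<and>
     (\<exists>P. partition_on (verts K) P \<and> card P = k \<and>
        (\<forall>S\<in>P. \<forall>a\<in>S. \<forall>b\<in>S. {a, b} \<notin> edges K) \<and>
        (\<forall>S\<in>P. \<forall>T\<in>P. S \<noteq> T \<longrightarrow> (\<forall>a\<in>S. \<forall>b\<in>T. {a, b} \<in> edges K)))"

definition is_walk :: "'a ugraph \<Rightarrow> 'a list \<Rightarrow> bool" where
  "is_walk H ws \<longleftrightarrow> ws \<noteq> [] \<and> set ws \<subseteq> verts H \<and>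
     (\<forall>i. Suc i < length ws \<longrightarrow> {ws ! i, ws ! Suc i} \<in> edges H)"

(* The cycle (v_1, ..., v_m, v_1) is represented by the list [v_1, ..., v_m], in which the
   closing vertex is not repeated; positions are taken modulo m. *)
definition cyc_edge :: "'a list \<Rightarrow> nat \<Rightarrow> 'a set" where
  "cyc_edge vs i = {vs ! (i mod length vs), vs ! (Suc i mod length vs)}"

definition is_cycle :: "'a ugraph \<Rightarrow> 'a list \<Rightarrow> bool" where
  "is_cycle G vs \<longleftrightarrow> length vs \<ge> 3 \<and> distinct vs \<and> set vs \<subseteq> verts G \<and>
     (\<forall>i<length vs. cyc_edge vs i \<in> edges G)"

definition H_coloring :: "'b ugraph \<Rightarrow> 'a ugraph \<Rightarrow> ('a set \<Rightarrow> 'b) \<Rightarrow> bool" where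
  "H_coloring H G c \<longleftrightarrow> (\<forall>e\<in>edges G. c e \<in> verts H)"

(* The last position, length vs, reads the first color once more. *)
definition H_cycle :: "'b ugraph \<Rightarrow> 'a ugraph \<Rightarrow> ('a set \<Rightarrow> 'b) \<Rightarrow> 'a list \<Rightarrow> bool" where
  "H_cycle H G c vs \<longleftrightarrow> is_cycle G vs \<and>
     is_walk H (map (\<lambda>i. c (cyc_edge vs i)) [0..<Suc (length vs)])"

(* The graph written G_x in the literature. *)
definition incidence_graph ::
    "'b ugraph \<Rightarrow> 'a ugraph \<Rightarrow> ('a set \<Rightarrow> 'b) \<Rightarrow> 'a \<Rightarrow> 'a set ugraph" where
  "incidence_graph H G c x =
     \<lparr>verts = {e \<in> edges G. x \<in> e},
      edges = {{a, b} | a b. a \<in> edges G \<and> x \<in> a \<and> b \<in> edges G \<and> x \<in> b \<and> a \<noteq> b \<and>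
                 {c a, c b} \<in> edges H}\<rparr>"

(* The predecessor of position i is i + length vs - 1 modulo length vs, which avoids
   truncated subtraction at i = 0. *)
definition obstructions :: "'b ugraph \<Rightarrow> ('a set \<Rightarrow> 'b) \<Rightarrow> 'a list \<Rightarrow> 'a set" where
  "obstructions H c vs =
     {vs ! i | i. i < length vs \<and>
        {c (cyc_edge vs (i + length vs - 1)), c (cyc_edge vs i)} \<notin> edges H}"

end

theory Submission
  imports Defs
begin

text \<open>
  Let \<open>M = V - {x}\<close> and let \<open>y \<rightarrow> w\<close> on \<open>M\<close> mean that there is no obstruction at \<open>y\<close> between
  \<open>yx\<close> and \<open>yw\<close>. If \<open>x\<close> lies on no \<open>H\<close>-cycle of length 4, then any two in-neighbours of \<open>w\<close>
  lie in the same part at \<open>x\<close> or in the same part at \<open>w\<close>. Since two equivalence relations cannot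
  jointly cover all pairs unless one of them does, all in-neighbours of \<open>w\<close> lie in one part at
  \<open>x\<close> or in one part at \<open>w\<close>. As parts have at most \<open>(n - 1) / 2\<close> elements, every in-degree is
  at most the out-degree; both have the same sum, so they agree everywhere. This forces the
  in-neighbourhood of every \<open>w\<close> to be a part at \<open>x\<close> with \<open>(n - 1) / 2\<close> elements. Because \<open>w\<close> is
  not its own in-neighbour, two different such parts occur, so there are only two parts at \<open>x\<close>,
  contradicting \<open>(n + 1) / 2 > 2\<close>.
\<close>

section \<open>Sizes of parts in a finite partition\<close>

text \<open>Every part outside \<open>R\<close> is nonempty, so it takes at least one element of
  \<open>A\<close> away from the union of \<open>R\<close>.\<close>

lemma partition_card_bound:
  assumes "partition_on A P" and "finite A" and "R \<subseteq> P"
  shows "card (\<Union>R) + card P \<le> card A + card R"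
proof -
  have fin: "finite P" using finite_elements[OF assms(2,1)] .
  have finS: "finite S" if "S \<in> P" for S
    using that assms(2) partition_onD1[OF assms(1)] by (metis Sup_upper finite_subset)
  let ?B = "\<Union>(P - R)"
  have A: "\<Union>R \<union> ?B = A"
    using assms(3) partition_onD1[OF assms(1)] by auto
  have disj: "\<Union>R \<inter> ?B = {}"
  proof -
    have "S \<inter> T = {}" if "S \<in> R" "T \<in> P - R" for S T
      using that assms(3) by (intro disjointD[OF partition_onD2[OF assms(1)]]) auto
    then show ?thesis by auto
  qed
  have "finite (\<Union>R \<union> ?B)" using assms(2) by (simp only: A)
  then have finU: "finite (\<Union>R)" "finite ?B"
    by simp_all
  have "card A = card (\<Union>R) + card ?B"
    using card_Un_disjoint[OF finU disj] by (simp only: A)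
  moreover have "card (P - R) \<le> card ?B"
  proof -
    have "card ?B = (\<Sum>S\<in>P - R. card S)"
      using finS pairwise_subset[OF partition_onD2[OF assms(1)] Diff_subset]
      by (intro card_Union_disjoint) auto
    moreover have "(\<Sum>S\<in>P - R. 1) \<le> (\<Sum>S\<in>P - R. card S)"
    proof (rule sum_mono)
      fix S assume "S \<in> P - R"
      then have "finite S" "S \<noteq> {}" using finS partition_onD3[OF assms(1)] by auto
      then show "1 \<le> card S" by (simp add: Suc_le_eq card_gt_0_iff)
    qed
    ultimately show ?thesis by simp
  qed
  moreover have "card P = card R + card (P - R)"
    using card_Diff_subset[OF finite_subset[OF assms(3) fin] assms(3)] card_mono[OF fin assms(3)]
    by simp
  ultimately show ?thesis by linarith
qed

lemma partition_part_card:
  assumes "partition_on A P" and "finite A" and "S \<in> P"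
  shows "card S + card P \<le> card A + 1"
  using partition_card_bound[of A P "{S}"] assms by simp

lemma partition_two_parts_card:
  assumes "partition_on A P" and "finite A" and "S \<in> P" "T \<in> P" "S \<noteq> T"
  shows "card S + card T + card P \<le> card A + 2"
proof -
  have "S \<inter> T = {}"
    using assms partition_onD2[OF assms(1)] by (auto simp: disjoint_def)
  moreover have "finite S" "finite T"
    using assms by (metis finite_subset partition_onD1 Sup_upper)+
  ultimately show ?thesis
    using partition_card_bound[of A P "{S, T}"] assms by (simp add: card_Un_disjoint)
qed

section \<open>Pairs covered by two partitions\<close>

text \<open>Elements outside the union of \<open>P\<close> are related to nothing, not even to
  themselves.\<close>

definition same_part :: "'a set set \<Rightarrow> 'a \<Rightarrow> 'a \<Rightarrow> bool" where
  "same_part P a b \<longleftrightarrow> (\<exists>S\<in>P. a \<in> S \<and> b \<in> S)"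

lemma same_part_iff:
  assumes "partition_on A P" and "S \<in> P" and "a \<in> S"
  shows "same_part P a b \<longleftrightarrow> b \<in> S"
  using disjointD[OF partition_onD2[OF assms(1)] assms(2)] assms(2,3)
  unfolding same_part_def by blast

text \<open>If \<open>N\<close> left both parts of one of its elements \<open>u\<close>, some
  \<open>a\<close> would lie in \<open>T\<close> but not \<open>S\<close> and some \<open>b\<close>
  in \<open>S\<close> but not \<open>T\<close>; neither relation covers this pair.\<close>

lemma subset_part_of_cover:
  assumes P: "partition_on A P" and Q: "partition_on B Q"
    and N: "N \<subseteq> A" "N \<subseteq> B" "N \<noteq> {}"
    and cover: "\<And>y z. y \<in> N \<Longrightarrow> z \<in> N \<Longrightarrow> same_part P y z \<or> same_part Q y z"
  shows "(\<exists>S\<in>P. N \<subseteq> S) \<or> (\<exists>T\<in>Q. N \<subseteq> T)"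
proof -
  obtain u where u: "u \<in> N" using N by auto
  obtain S where S: "S \<in> P" "u \<in> S" using u N P partition_onD1 by blast
  obtain T where T: "T \<in> Q" "u \<in> T" using u N Q partition_onD1 by blast
  note iffS = same_part_iff[OF P S] and iffT = same_part_iff[OF Q T]
  have "N \<subseteq> S \<or> N \<subseteq> T"
  proof (rule ccontr)
    assume "\<not> ?thesis"
    then obtain a b where a: "a \<in> N" "a \<notin> S" and b: "b \<in> N" "b \<notin> T" by auto
    have aT: "a \<in> T" and bS: "b \<in> S" using cover u a b iffS iffT by blast+
    show False
      using cover[of a b] a b same_part_iff[OF Q T(1) aT] same_part_iff[OF P S(1) bS]
      by (auto simp: same_part_def)
  qed
  then show ?thesis using S T by auto
qed

section \<open>Degree counting on abstract partitions\<close>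

text \<open>The core of the argument without colors: lying in different parts of \<open>P v\<close>
  stands for the absence of an obstruction at \<open>v\<close>.\<close>

lemma four_cycle_avoiding_parts:
  assumes fin: "finite V" and x: "x \<in> V" and V3: "3 < card V"
    and P: "\<And>v. v \<in> V \<Longrightarrow> partition_on (V - {v}) (P v)"
    and k: "\<And>v. v \<in> V \<Longrightarrow> card V + 1 \<le> 2 * card (P v)"
  shows "\<exists>y w z. distinct [x, y, w, z] \<and> {y, w, z} \<subseteq> V \<and>
    \<not> same_part (P y) x w \<and> \<not> same_part (P w) y z \<and> \<not> same_part (P z) x w \<and>
    \<not> same_part (P x) y z"
proof (rule ccontr)
  assume neg: "\<not> ?thesis"
  \<comment> \<open>Without \<open>y \<noteq> w\<close> there would be loops, since \<open>y\<close>
    is in no part of \<open>P y\<close>.\<close>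
  define R where "R y w \<longleftrightarrow> y \<noteq> w \<and> \<not> same_part (P y) x w" for y w
  define M where "M = V - {x}"
  define inN where "inN w = {y \<in> M. R y w}" for w
  define outN where "outN y = {w \<in> M. R y w}" for y
  have finM: "finite M" using fin M_def by simp
  have card_minus: "card (V - {v}) + 1 = card V" if "v \<in> V" for v
    using that fin by (metis Suc_eq_plus1 card_Suc_Diff1)
  have part_le: "2 * card S + 1 \<le> card V" if "v \<in> V" "S \<in> P v" for v S
    using partition_part_card[OF P _ that(2)] k card_minus fin that(1) by fastforce
  have pair: "same_part (P x) y z \<or> same_part (P w) y z"
    if "w \<in> M" "y \<in> inN w" "z \<in> inN w" for y z w
  proof (cases "y = z")
    case True
    then have "y \<in> \<Union>(P x)"
      using that partition_onD1[OF P[OF x]] by (auto simp: inN_def M_def)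
    then show ?thesis
      using True by (auto simp: same_part_def)
  next
    case False
    have "distinct [x, y, w, z]" "{y, w, z} \<subseteq> V"
      "\<not> same_part (P y) x w" "\<not> same_part (P z) x w"
      using that False by (auto simp: inN_def R_def M_def)
    then show ?thesis using neg by blast
  qed
  \<comment> \<open>With \<open>S\<close> the part at \<open>w\<close> containing \<open>x\<close>,
    the out-degree is \<open>card V - 1 - card S\<close>, at least half of
    \<open>card V - 1\<close>. The equality clause records the only case in which the in-degree can
    reach it.\<close>
  have key: "card (inN w) \<le> card (outN w) \<and>
      (card (inN w) = card (outN w) \<longrightarrow> inN w \<in> P x \<and> 2 * card (inN w) + 1 = card V)"
    if w: "w \<in> M" for w
  proof -
    have wV: "w \<in> V" and wx: "w \<noteq> x" using w M_def by auto
    obtain S where S: "S \<in> P w" "x \<in> S"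
      using partition_onD1[OF P[OF wV]] x wx by blast
    have sub: "S \<subseteq> V - {w}" using partition_onD1[OF P[OF wV]] S by blast
    have finS: "finite S" using sub fin finite_subset by blast
    have "outN w = (V - {w}) - S"
      using same_part_iff[OF P[OF wV] S] S(2) by (auto simp: outN_def R_def M_def)
    then have out: "card (outN w) + card S + 1 = card V"
      using card_Diff_subset[OF finS sub] card_mono[OF _ sub] card_minus[OF wV] fin by simp
    have S1: "card S \<ge> 1" using S finS by (metis One_nat_def Suc_leI card_gt_0_iff empty_iff)
    have Sle: "2 * card S + 1 \<le> card V" using part_le wV S(1) by blast
    have inM: "inN w \<subseteq> V - {x}" "inN w \<subseteq> V - {w}"
      by (auto simp: inN_def M_def R_def)
    show ?thesis
    proof (cases "inN w = {}")
      case True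
      then show ?thesis using out Sle V3 by simp
    next
      case False
      consider (at_x) C where "C \<in> P x" "inN w \<subseteq> C" | (at_w) T where "T \<in> P w" "inN w \<subseteq> T"
        using subset_part_of_cover[OF P[OF x] P[OF wV] inM False] pair[OF w] by blast
      then show ?thesis
      proof cases
        case at_x
        have finC: "finite C"
          using partition_onD1[OF P[OF \<open>x \<in> V\<close>]] at_x(1) fin
          by (metis Sup_upper finite_Diff finite_subset)
        have "card (inN w) \<le> card C" using at_x(2) finC card_mono by blast
        moreover have "2 * card C + 1 \<le> card V" using part_le \<open>x \<in> V\<close> at_x(1) by blast
        moreover have "inN w = C" if "card (inN w) = card C"
          using card_subset_eq[OF finC at_x(2) that] .
        ultimately show ?thesis using out Sle at_x(1)
          by (cases "card (inN w) = card C") auto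
      next
        case at_w
        have finT: "finite T"
          using partition_onD1[OF P[OF wV]] at_w(1) fin
          by (metis Sup_upper finite_Diff finite_subset)
        show ?thesis
        proof (cases "T = S")
          case True
          \<comment> \<open>Losing \<open>x\<close> makes the inequality between the degrees
            strict.\<close>
          have "inN w \<subseteq> S - {x}" using at_w(2) True inM by blast
          then have "card (inN w) \<le> card S - 1"
            using finS S(2) by (metis card_Diff_singleton card_mono finite_Diff)
          then show ?thesis using out Sle S1 by linarith
        next
          case False
          have "card (inN w) \<le> card T" using at_w(2) finT card_mono by blast
          \<comment> \<open>Together \<open>S\<close> and \<open>T\<close> have at most half of
            \<open>card V + 1\<close> elements, so the inequality is again strict because
            \<open>card V > 3\<close>.\<close>
          moreover have "card S + card T + card (P w) \<le> card (V - {w}) + 2"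
            using partition_two_parts_card[OF P[OF wV] _ S(1) at_w(1)] False fin by auto
          ultimately show ?thesis using out k[OF wV] card_minus[OF wV] V3 by linarith
        qed
      qed
    qed
  qed
  \<comment> \<open>Both sums count the pairs in \<open>M\<close> related by
    \<open>R\<close>.\<close>
  have "(\<Sum>w\<in>M. card (outN w)) = (\<Sum>w\<in>M. card (inN w))"
    unfolding outN_def inN_def by (rule sum_multicount_gen) (use finM in auto)
  then have "card (inN w) = card (outN w)" if "w \<in> M" for w
    using sum_mono_inv[of "\<lambda>w. card (inN w)" M "\<lambda>w. card (outN w)" w] key that finM by auto
  then have big: "inN w \<in> P x" "2 * card (inN w) + 1 = card V" if "w \<in> M" for w
    using key that by blast+
  have not_self: "w \<notin> inN w" for w by (simp add: inN_def R_def)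
  have "card M + 1 = card V" using card_minus[OF x] M_def by simp
  then have "M \<noteq> {}" using V3 by auto
  then obtain u where u: "u \<in> M" by auto
  then have "inN u \<noteq> {}" using big[OF u] V3 by auto
  then obtain w where w: "w \<in> inN u" by auto
  then have wM: "w \<in> M" by (simp add: inN_def)
  have "inN u \<noteq> inN w" using w not_self by blast
  \<comment> \<open>Two distinct parts of this size exhaust \<open>V - {x}\<close>, which forces
    \<open>card (P x) \<le> 2\<close>.\<close>
  then have "card (inN u) + card (inN w) + card (P x) \<le> card (V - {x}) + 2"
    using partition_two_parts_card[OF P[OF x] _ big(1)[OF u] big(1)[OF wM]] fin by simp
  then show False
    using big(2)[OF u] big(2)[OF wM] k[OF x] card_minus[OF x] V3 by linarith
qed

section \<open>Transfer to the colored graph\<close>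

text \<open>Edges at \<open>v\<close> correspond to their other endpoints, so the partition of the
  edges is carried over to \<open>verts G - {v}\<close> by this bijection.\<close>

lemma incidence_partition:
  assumes G: "complete_graph G" and v: "v \<in> verts G"
    and cm: "complete_multipartite m (incidence_graph H G c v)"
  shows "\<exists>Q. partition_on (verts G - {v}) Q \<and> card Q = m \<and>
    (\<forall>a\<in>verts G - {v}. \<forall>b\<in>verts G - {v}. \<not> same_part Q a b \<longrightarrow> {c {v, a}, c {v, b}} \<in> edges H)"
proof -
  define I where "I = verts (incidence_graph H G c v)"
  define f where "f e = the_elem (e - {v})" for e :: "'a set"
  obtain P where P: "partition_on I P" and cP: "card P = m"
    and adj: "\<forall>S\<in>P. \<forall>T\<in>P. S \<noteq> T \<longrightarrow> (\<forall>a\<in>S. \<forall>b\<in>T.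
      {a, b} \<in> edges (incidence_graph H G c v))"
    using cm unfolding complete_multipartite_def I_def[symmetric] by (elim conjE exE) (rule that)
  have f: "f {v, a} = a" if "a \<noteq> v" for a
    using that by (simp add: f_def insert_Diff_if)
  have I: "I = (\<lambda>a. {v, a}) ` (verts G - {v})"
  proof
    show "(\<lambda>a. {v, a}) ` (verts G - {v}) \<subseteq> I"
      using G v by (auto simp: I_def incidence_graph_def complete_graph_def)
    show "I \<subseteq> (\<lambda>a. {v, a}) ` (verts G - {v})"
    proof
      fix e assume "e \<in> I"
      then have e: "e \<in> edges G" "v \<in> e" by (auto simp: I_def incidence_graph_def)
      then have "e \<subseteq> verts G" "card e = 2"
        using G by (auto simp: complete_graph_def simple_graph_def)
      moreover from this(2) e(2) obtain a where "e = {v, a}" "a \<noteq> v"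
        by (auto simp: card_2_iff)
      ultimately show "e \<in> (\<lambda>a. {v, a}) ` (verts G - {v})" by auto
    qed
  qed
  have inj: "inj_on f I" by (auto simp: I inj_on_def f)
  have img: "f ` I = verts G - {v}"
    using f by (simp add: I image_image cong: image_cong_simp)
  define Q where "Q = (`) f ` P"
  \<comment> \<open>\<open>partition_on_inj_image\<close> yields the image partition with the empty
    set removed.\<close>
  have "Q - {{}} = Q" using partition_onD3[OF P] by (auto simp: Q_def)
  then have 1: "partition_on (verts G - {v}) Q"
    using partition_on_inj_image[OF P inj] img by (simp add: Q_def)
  have "inj_on ((`) f) P"
    using inj_on_image[of f P] inj partition_onD1[OF P] by simp
  then have 2: "card Q = m" using cP by (simp add: Q_def card_image)
  have "{c {v, a}, c {v, b}} \<in> edges H"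
    if a: "a \<in> verts G - {v}" and b: "b \<in> verts G - {v}" and ns: "\<not> same_part Q a b" for a b
  proof -
    obtain S where S: "S \<in> P" "{v, a} \<in> S" using a I partition_onD1[OF P] by blast
    obtain T where T: "T \<in> P" "{v, b} \<in> T" using b I partition_onD1[OF P] by blast
    have "a \<in> f ` S" "b \<in> f ` T"
      using imageI[OF S(2), of f] imageI[OF T(2), of f] a b f by simp_all
    then have "S \<noteq> T" using ns S(1) by (auto simp: same_part_def Q_def)
    then have "{{v, a}, {v, b}} \<in> edges (incidence_graph H G c v)" using adj S T by blast
    \<comment> \<open>The pair is unordered, so \<open>e\<close> and \<open>e'\<close> may come
      swapped; taking the image under \<open>c\<close> of both sides makes this harmless.\<close>
    then obtain e e' where "{{v, a}, {v, b}} = {e, e'}" "{c e, c e'} \<in> edges H"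
      by (auto simp: incidence_graph_def)
    then have "{c {v, a}, c {v, b}} = {c e, c e'}"
      by (metis image_empty image_insert)
    then show ?thesis using \<open>{c e, c e'} \<in> edges H\<close> by simp
  qed
  then show ?thesis using 1 2 by blast
qed

theorem theorem4:
  fixes H :: "'b ugraph" and G :: "'a ugraph" and c :: "'a set \<Rightarrow> 'b"
    and n :: nat and k :: "'a \<Rightarrow> nat"
  assumes "loop_graph H"
    and "complete_graph G"
    and "card (verts G) = n" and "n \<ge> 9"
    and "H_coloring H G c"
    and "\<forall>x\<in>verts G. complete_multipartite (k x) (incidence_graph H G c x)"
    and "\<forall>x\<in>verts G. real (k x) \<ge> (real n + 1) / 2"
    and "\<not> (\<exists>vs. is_cycle G vs \<and> length vs = 3 \<and> card (obstructions H c vs) = 2)"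
    and "\<not> (\<exists>vs. is_cycle G vs \<and> length vs = 4 \<and> card (obstructions H c vs) = 3)"
  shows "\<forall>x\<in>verts G. \<exists>vs. H_cycle H G c vs \<and> length vs = 4 \<and> x \<in> set vs"
proof
  fix x assume x: "x \<in> verts G"
  have fin: "finite (verts G)"
    using assms(2) by (simp add: complete_graph_def simple_graph_def)
  have "\<forall>v. \<exists>Q. v \<in> verts G \<longrightarrow> partition_on (verts G - {v}) Q \<and> card Q = k v \<and>
    (\<forall>a\<in>verts G - {v}. \<forall>b\<in>verts G - {v}. \<not> same_part Q a b \<longrightarrow> {c {v, a}, c {v, b}} \<in> edges H)"
    using incidence_partition[OF assms(2)] assms(6) by blast
  then obtain P where P: "\<And>v. v \<in> verts G \<Longrightarrow> partition_on (verts G - {v}) (P v)"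
    and cP: "\<And>v. v \<in> verts G \<Longrightarrow> card (P v) = k v"
    and ok: "\<And>v a b. v \<in> verts G \<Longrightarrow> a \<in> verts G - {v} \<Longrightarrow> b \<in> verts G - {v} \<Longrightarrow>
      \<not> same_part (P v) a b \<Longrightarrow> {c {v, a}, c {v, b}} \<in> edges H"
    by metis
  have "card (verts G) + 1 \<le> 2 * card (P v)" if "v \<in> verts G" for v
    using assms(3,7) that cP[OF that] by (force simp: field_simps)
  then obtain y w z where d: "distinct [x, y, w, z]" and V: "{y, w, z} \<subseteq> verts G"
    and ns: "\<not> same_part (P y) x w" "\<not> same_part (P w) y z" "\<not> same_part (P z) x w"
      "\<not> same_part (P x) y z"
    using four_cycle_avoiding_parts[of "verts G" x P] fin x assms(3,4) P by auto
  let ?vs = "[x, y, w, z]"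
  have E: "{x, y} \<in> edges G" "{y, w} \<in> edges G" "{w, z} \<in> edges G" "{z, x} \<in> edges G"
    using assms(2) d V x by (auto simp: complete_graph_def)
  have cyc: "is_cycle G ?vs"
    unfolding is_cycle_def
  proof (intro conjI allI impI)
    fix i assume "i < length ?vs"
    then consider "i = 0" | "i = 1" | "i = 2" | "i = 3" by fastforce
    then show "cyc_edge ?vs i \<in> edges G"
      using E by cases (simp_all add: cyc_edge_def)
  qed (use d V x in auto)
  have col: "c e \<in> verts H" if "e \<in> edges G" for e
    using assms(5) that by (simp add: H_coloring_def)
  \<comment> \<open>The color changes at \<open>y\<close>, \<open>w\<close>, \<open>z\<close> and
    \<open>x\<close>, in this order; the last one closes the walk.\<close>
  have "{c {x, y}, c {y, w}} \<in> edges H" "{c {y, w}, c {w, z}} \<in> edges H"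
    "{c {w, z}, c {z, x}} \<in> edges H" "{c {z, x}, c {x, y}} \<in> edges H"
    using ok[of y x w] ok[of w y z] ok[of z x w] ok[of x y z] ns d V x
    by (auto simp: insert_commute)
  moreover have "map (\<lambda>i. c (cyc_edge ?vs i)) [0..<Suc (length ?vs)] =
      [c {x, y}, c {y, w}, c {w, z}, c {z, x}, c {x, y}]"
    by (simp add: cyc_edge_def)
  ultimately have "is_walk H (map (\<lambda>i. c (cyc_edge ?vs i)) [0..<Suc (length ?vs)])"
    using E col by (simp add: is_walk_def All_less_Suc nth_Cons')
  then have "H_cycle H G c ?vs" using cyc by (simp only: H_cycle_def)
  then show "\<exists>vs. H_cycle H G c vs \<and> length vs = 4 \<and> x \<in> set vs"
    by (intro exI[of _ ?vs]) simp
qed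

end
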